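(* Let $\mathbb K$ be a field and, for $n\ge 0$, let $A_n$ be the alternating linear graph on $n+1$ vertices. Then for every $n\geq 1$: \[\mathrm{H}^*_\mu(A_n;\mathbb K)\cong\begin{cases}\mathrm{H}^*_\mu(A_{n-1};\mathbb K) & \text{if } n\equiv 0\pmod 3,\\ 0 & \text{if } n\equiv 1\pmod 3,\\ \mathrm{H}^{*-1}_\mu(A_{n-2};\mathbb K)&\text{if } n\equiv 2\pmod 3.\end{cases}\]
   Context: An oriented linear graph on $n$ vertices is a digraph with vertices $v_0,\dots,v_{n-1}$ such that for each $i=1,\dots,n-1$ exactly one of $(v_i,v_{i-1})$, $(v_{i-1},v_i)$ is an edge, and there are no other edges. It is alternating if every vertex is a source of all its incident edges or a target of all its incident edges (equivalently, consecutive edges have opposite orientations); $A_n$ denotes the alternating linear graph on $n+1$ vertices, unique up to reversing all orientations. A multipath of a digraph $G$ is a spanning subgraph each of whose connected components is a single vertex or a simple directed path. Multipath cohomology $\mathrm{H}^*_\mu(G;\mathbb K)$ is the cohomology of the complex whose degree $n$ part has basis $b_H$ for multipaths $H$ with $n$ edges, with $d b_H=\sum_e(-1)^{\epsilon(H,H\cup e)}b_{H\cup e}$ over edges $e\notin H$ with $H\cup e$ a multipath, $\epsilon(H,H\cup e)$ = number of edges of $H$ preceding $e$ in a fixed total order of $E(G)$. *)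

theory Defs
  imports
    "Graph_Theory.Digraph_Component"
    "HOL-Algebra.Module"
    "HOL-Library.Function_Algebras"
begin

text \<open>A digraph is a \<open>pair_pre_digraph\<close>: a vertex set together with a set of ordered pairs.\<close>

definition oriented_linear_graph :: "nat \<Rightarrow> 'a pair_pre_digraph \<Rightarrow> bool" where
  "oriented_linear_graph n G \<longleftrightarrow>
    (\<exists>v :: nat \<Rightarrow> 'a.
       bij_betw v {..<n} (pverts G) \<and>
       (\<forall>i\<in>{1..<n}. ((v i, v (i - 1)) \<in> parcs G) \<noteq> ((v (i - 1), v i) \<in> parcs G)) \<and>
       (\<forall>e\<in>parcs G. \<exists>i\<in>{1..<n}. e = (v i, v (i - 1)) \<or> e = (v (i - 1), v i)))"

definition alternating :: "'a pair_pre_digraph \<Rightarrow> bool" where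
  "alternating G \<longleftrightarrow>
    (\<forall>v\<in>pverts G.
       (\<forall>e\<in>parcs G. v = fst e \<or> v = snd e \<longrightarrow> v = fst e) \<or>
       (\<forall>e\<in>parcs G. v = fst e \<or> v = snd e \<longrightarrow> v = snd e))"

text \<open>
  \<open>is_A n G\<close>: the digraph \<open>G\<close> is an alternating linear graph on \<open>n + 1\<close> vertices. Since this
  determines \<open>G\<close> only up to isomorphism and reversal of all orientations, it is a predicate, so
  that statements about \<open>A\<^sub>n\<close> cover both orientations.
\<close>

definition is_A :: "nat \<Rightarrow> 'a pair_pre_digraph \<Rightarrow> bool" where
  "is_A n G \<longleftrightarrow> oriented_linear_graph (n + 1) G \<and> alternating G"

text \<open>A path without arcs is allowed here, which covers the components that are single vertices.\<close>

definition is_simple_path :: "('a, 'b) pre_digraph \<Rightarrow> bool" where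
  "is_simple_path C \<longleftrightarrow>
    (\<exists>u p w. pre_digraph.apath C u p w \<and>
       verts C = set (pre_digraph.awalk_verts C u p) \<and> arcs C = set p)"

text \<open>Here \<open>connected\<close> refers to the underlying undirected graph.\<close>

definition multipath :: "'a pair_pre_digraph \<Rightarrow> 'a pair_pre_digraph \<Rightarrow> bool" where
  "multipath G H \<longleftrightarrow>
    spanning (with_proj H) (with_proj G) \<and>
    (\<forall>C. pre_digraph.max_subgraph (with_proj H) connected C \<longrightarrow> is_simple_path C)"

definition add_edge :: "'a pair_pre_digraph \<Rightarrow> 'a \<times> 'a \<Rightarrow> 'a pair_pre_digraph" where
  "add_edge H e = H\<lparr>parcs := insert e (parcs H)\<rparr>"

text \<open>
  The multipath complex of \<open>G\<close> with respect to a total order \<open>r\<close> on the edges of \<open>G\<close>. A cochain is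
  a function on digraphs supported on the multipaths of \<open>G\<close>; for finite \<open>G\<close> these form the vector
  space with basis \<open>basis_vec H\<close>, \<open>H\<close> ranging over the multipaths. Degrees are integers, so that the
  cochain groups vanish in negative degrees.
\<close>

definition scale :: "'k::field \<Rightarrow> ('v \<Rightarrow> 'k) \<Rightarrow> 'v \<Rightarrow> 'k" where
  "scale c f = (\<lambda>x. c * f x)"

definition cochains :: "'a pair_pre_digraph \<Rightarrow> int \<Rightarrow> ('a pair_pre_digraph \<Rightarrow> 'k::field) set" where
  "cochains G i = {f. \<forall>H. f H \<noteq> 0 \<longrightarrow> multipath G H \<and> int (card (parcs H)) = i}"

definition basis_vec :: "'a pair_pre_digraph \<Rightarrow> 'a pair_pre_digraph \<Rightarrow> 'k::field" where
  "basis_vec H = (\<lambda>H'. if H' = H then 1 else 0)"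

definition epsilon :: "('a \<times> 'a) rel \<Rightarrow> 'a pair_pre_digraph \<Rightarrow> 'a \<times> 'a \<Rightarrow> nat" where
  "epsilon r H e = card {f \<in> parcs H. f \<noteq> e \<and> (f, e) \<in> r}"

definition d_basis ::
  "'a pair_pre_digraph \<Rightarrow> ('a \<times> 'a) rel \<Rightarrow> 'a pair_pre_digraph \<Rightarrow> 'a pair_pre_digraph \<Rightarrow> 'k::field"
  where
  "d_basis G r H =
    (\<Sum>e | e \<in> parcs G - parcs H \<and> multipath G (add_edge H e).
       scale ((- 1) ^ epsilon r H e) (basis_vec (add_edge H e)))"

definition differential ::
  "'a pair_pre_digraph \<Rightarrow> ('a \<times> 'a) rel \<Rightarrow> ('a pair_pre_digraph \<Rightarrow> 'k::field) \<Rightarrow>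
    'a pair_pre_digraph \<Rightarrow> 'k"
  where
  "differential G r f = (\<Sum>H | multipath G H. scale (f H) (d_basis G r H))"

definition cocycles ::
  "'a pair_pre_digraph \<Rightarrow> ('a \<times> 'a) rel \<Rightarrow> int \<Rightarrow> ('a pair_pre_digraph \<Rightarrow> 'k::field) set" where
  "cocycles G r i = {f \<in> cochains G i. differential G r f = 0}"

definition coboundaries ::
  "'a pair_pre_digraph \<Rightarrow> ('a \<times> 'a) rel \<Rightarrow> int \<Rightarrow> ('a pair_pre_digraph \<Rightarrow> 'k::field) set" where
  "coboundaries G r i = differential G r ` cochains G (i - 1)"

text \<open>
  The quotient space \<open>Z / B\<close>, as a set of cosets with its linear structure. Adding \<open>B\<close> in \<open>smult\<close>
  matters only for the scalar \<open>0\<close>. The fields \<open>mult\<close> and \<open>one\<close> of the record play no role for a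
  module.
\<close>

definition quotient_space ::
  "('v \<Rightarrow> 'k::field) set \<Rightarrow> ('v \<Rightarrow> 'k) set \<Rightarrow> ('k, ('v \<Rightarrow> 'k) set) module" where
  "quotient_space Z B =
    \<lparr>carrier = {{z + y | y. y \<in> B} | z. z \<in> Z},
     mult = undefined, one = undefined,
     zero = B,
     add = (\<lambda>X Y. {x + y | x y. x \<in> X \<and> y \<in> Y}),
     smult = (\<lambda>c X. {scale c x + y | x y. x \<in> X \<and> y \<in> B})\<rparr>"

text \<open>The first argument fixes the field of coefficients.\<close>

definition multipath_cohomology ::
  "'k::field itself \<Rightarrow> 'a pair_pre_digraph \<Rightarrow> ('a \<times> 'a) rel \<Rightarrow> int \<Rightarrow>
    ('k, ('a pair_pre_digraph \<Rightarrow> 'k) set) module" where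
  "multipath_cohomology K G r i = quotient_space (cocycles G r i) (coboundaries G r i)"

definition linearly_isomorphic :: "('k::field, 'v) module \<Rightarrow> ('k, 'w) module \<Rightarrow> bool"
  (infix \<open>\<cong>\<^sub>l\<^sub>i\<^sub>n\<close> 50) where
  "M \<cong>\<^sub>l\<^sub>i\<^sub>n N \<longleftrightarrow>
    (\<exists>h \<in> iso (add_monoid M) (add_monoid N).
       \<forall>c. \<forall>x\<in>carrier M. h (c \<odot>\<^bsub>M\<^esub> x) = c \<odot>\<^bsub>N\<^esub> h x)"

lemma is_A_exists: "\<exists>G :: nat pair_pre_digraph. is_A n G"
proof -
  define E where "E = {(i, j). i \<le> n \<and> j \<le> n \<and> even i \<and> (j = i + 1 \<or> i = j + 1)}"
  define G where "G = \<lparr>pverts = {..<n + 1}, parcs = E\<rparr>"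
  have "oriented_linear_graph (n + 1) G"
    unfolding oriented_linear_graph_def
  proof (intro exI[of _ id] conjI ballI)
    fix e assume "e \<in> parcs G"
    then obtain i j where e: "e = (i, j)" "i \<le> n" "j \<le> n" "j = i + 1 \<or> i = j + 1"
      by (auto simp: G_def E_def)
    then show "\<exists>i\<in>{1..<n + 1}. e = (id i, id (i - 1)) \<or> e = (id (i - 1), id i)"
      by (intro bexI[of _ "max i j"]) auto
  qed (auto simp: G_def E_def)
  moreover have "alternating G"
    by (auto simp: alternating_def G_def E_def)
  ultimately show ?thesis
    unfolding is_A_def by blast
qed

end

theory Submission
  imports Defs
begin

text \<open>
  Consecutive edges of \<open>A\<^sub>n\<close> never lie on a common directed path, so the multipaths are the sets of
  pairwise non-consecutive edges, that is, the subsets of \<open>{1..n}\<close> without consecutive elements.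
  Filter their complex by the requirement \<open>{2, 5, \<dots>, 3 * j - 1} \<subseteq> S\<close>. As long as
  \<open>3 * j + 1 \<le> n\<close>, toggling the element \<open>3 * j + 1\<close> contracts the quotient of two successive
  steps. If \<open>n mod 3 = 1\<close>, this exhausts the complex; otherwise only the set
  \<open>{k \<in> {1..n}. k mod 3 = 2}\<close> survives, and the cohomology is one-dimensional, concentrated in
  degree \<open>(n + 1) div 3\<close>. All three claims are read off from this.
\<close>

section \<open>The complex of sparse sets\<close>

text \<open>The total order behind the signs is arbitrary and need not follow the path, so no
  explicit sign formula is available. What holds for every order is that signs square to one and
  that the two ways of adding two edges differ by a sign. The contraction is carried out from these
  two facts alone, over any field, including characteristic two.

  The period 3 comes from cutting \<open>{1..n}\<close> into blocks of three. A chosen middle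
  element excludes both of its neighbours, so the blocks no longer interact. If
  \<open>n mod 3 = 1\<close>, the last block consists of its first element only; nothing can then
  obstruct toggling that element, and no class survives.

  The graphs to be compared have unrelated vertex types and edge orders. No map between their
  complexes is built: dimension and degree of the cohomology decide the isomorphism.\<close>

definition sparse :: "nat \<Rightarrow> nat set \<Rightarrow> bool" where
  "sparse n S \<longleftrightarrow> S \<subseteq> {1..n} \<and> (\<forall>k\<in>S. Suc k \<notin> S)"

lemma sparse_finite: "sparse n S \<Longrightarrow> finite S"
  unfolding sparse_def using finite_subset by blast

lemma sparse_subset: "sparse n S \<Longrightarrow> S' \<subseteq> S \<Longrightarrow> sparse n S'"
  unfolding sparse_def by blast

text \<open>\<open>s S a\<close> is the sign attached to inserting \<open>a\<close> into
  \<open>S\<close>. The first law makes every sign its own inverse, which the contraction needs; the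
  second one makes the differential square to zero.\<close>

locale anticommuting_signs =
  fixes n :: nat and s :: "nat set \<Rightarrow> nat \<Rightarrow> 'k::field"
  assumes sign_square: "s S a * s S a = 1"
    and sign_anticommute:
      "S \<subseteq> {1..n} \<Longrightarrow> a \<in> {1..n} - S \<Longrightarrow> b \<in> {1..n} - S \<Longrightarrow> a \<noteq> b \<Longrightarrow>
        s S a * s (insert a S) b = - (s S b * s (insert b S) a)"
begin

section \<open>Cochains on sparse sets, their differential and filtration\<close>

definition cochain :: "int \<Rightarrow> (nat set \<Rightarrow> 'k) \<Rightarrow> bool" where
  "cochain i f \<longleftrightarrow> (\<forall>S. f S \<noteq> 0 \<longrightarrow> sparse n S \<and> int (card S) = i)"

text \<open>The differential is given by its coefficients: the one at \<open>S\<close> collects all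
  ways of reaching \<open>S\<close> by an insertion. The cut-off is needed because
  \<open>S - {k}\<close> may be sparse when \<open>S\<close> is not.\<close>

definition d :: "(nat set \<Rightarrow> 'k) \<Rightarrow> nat set \<Rightarrow> 'k" where
  "d f S = (if sparse n S then \<Sum>k\<in>S. s (S - {k}) k * f (S - {k}) else 0)"

definition filt :: "nat \<Rightarrow> (nat set \<Rightarrow> 'k) \<Rightarrow> bool" where
  "filt j f \<longleftrightarrow> (\<forall>S. f S \<noteq> 0 \<longrightarrow> (\<forall>l<j. 3 * l + 2 \<in> S))"

lemma cochain_add: "cochain i f \<Longrightarrow> cochain i g \<Longrightarrow> cochain i (\<lambda>S. f S + g S)"
  unfolding cochain_def by (metis add.right_neutral)

lemma cochain_diff: "cochain i f \<Longrightarrow> cochain i g \<Longrightarrow> cochain i (\<lambda>S. f S - g S)"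
  unfolding cochain_def by (metis diff_zero diff_self)

lemma d_add: "d (\<lambda>S. f S + g S) S = d f S + d g S"
  by (simp add: d_def distrib_left sum.distrib)

lemma d_diff: "d (\<lambda>S. f S - g S) S = d f S - d g S"
  by (simp add: d_def right_diff_distrib sum_subtractf)

lemma cochain_d:
  assumes "cochain i f"
  shows "cochain (i + 1) (d f)"
  unfolding cochain_def
proof (intro allI impI)
  fix S assume nz: "d f S \<noteq> 0"
  then have S: "sparse n S" by (auto simp: d_def split: if_splits)
  with nz have "\<exists>k\<in>S. f (S - {k}) \<noteq> 0"
    by (metis (no_types, lifting) d_def mult_zero_right sum.neutral)
  then obtain k where k: "k \<in> S" "f (S - {k}) \<noteq> 0" by blast
  then have "int (card (S - {k})) = i"
    using assms by (auto simp: cochain_def)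
  moreover have "card S = Suc (card (S - {k}))"
    using k sparse_finite[OF S] by (metis card.remove)
  ultimately show "sparse n S \<and> int (card S) = i + 1" using S by simp
qed

text \<open>The differential only enlarges sets, so required elements stay present.\<close>

lemma filt_d:
  assumes "filt j f"
  shows "filt j (d f)"
  unfolding filt_def
proof (intro allI impI)
  fix S l assume nz: "d f S \<noteq> 0" and l: "l < j"
  then have "\<exists>k\<in>S. f (S - {k}) \<noteq> 0"
    by (metis (no_types, lifting) d_def mult_zero_right sum.neutral)
  then show "3 * l + 2 \<in> S"
    using assms l by (auto simp: filt_def)
qed

text \<open>Any two elements of \<open>S\<close> can be removed in two orders, and the two
  contributions cancel by anticommutation.\<close>

lemma d_d: "d (d f) S = 0"
proof (cases "sparse n S")
  case True
  note fin = sparse_finite[OF True]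
  define A where "A k m = s (S - {k}) k * (s (S - {k} - {m}) m * f (S - {k} - {m}))" for k m
  have anti: "A k m = - A m k" if "k \<in> S" "m \<in> S" "k \<noteq> m" for k m
  proof -
    let ?R = "S - {k} - {m}"
    have R: "?R \<subseteq> {1..n}" "k \<in> {1..n} - ?R" "m \<in> {1..n} - ?R" "insert m ?R = S - {k}"
      "insert k ?R = S - {m}" "S - {m} - {k} = ?R"
      using True that by (auto simp: sparse_def)
    have "s ?R m * s (S - {k}) k = - (s ?R k * s (S - {m}) m)"
      using sign_anticommute[OF R(1,3,2)] that R by simp
    moreover have "A k m = (s ?R m * s (S - {k}) k) * f ?R"
      unfolding A_def by (simp only: mult_ac)
    ultimately have "A k m = - (s ?R k * s (S - {m}) m) * f ?R"
      by (simp only:)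
    also have "\<dots> = - A m k"
      unfolding A_def R(6) by (simp add: mult_ac)
    finally show ?thesis .
  qed
  \<comment> \<open>Splitting by order and swapping one half makes the cancellation explicit.
    Showing that the sum equals its own negative would prove nothing in characteristic two.\<close>
  have sep: "(\<Sum>m\<in>S - {k}. A k m) = (\<Sum>m | m \<in> S \<and> m < k. A k m) + (\<Sum>m | m \<in> S \<and> k < m. A k m)" for k
  proof -
    have split: "S - {k} = {m. m \<in> S \<and> m < k} \<union> {m. m \<in> S \<and> k < m}"
      by auto
    show ?thesis
      unfolding split by (rule sum.union_disjoint) (use fin in auto)
  qed
  have "sparse n (S - {k})" for k
    by (rule sparse_subset[OF True]) auto
  then have "d (d f) S = (\<Sum>k\<in>S. \<Sum>m\<in>S - {k}. A k m)"
    unfolding d_def A_def using True by (simp add: sum_distrib_left)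
  also have "\<dots> = (\<Sum>k\<in>S. \<Sum>m | m \<in> S \<and> m < k. A k m) + (\<Sum>k\<in>S. \<Sum>m | m \<in> S \<and> k < m. A k m)"
    by (simp add: sep sum.distrib)
  also have "(\<Sum>k\<in>S. \<Sum>m | m \<in> S \<and> m < k. A k m) = (\<Sum>m\<in>S. \<Sum>k | k \<in> S \<and> m < k. A k m)"
    by (rule sum.swap_restrict) (use fin in auto)
  also have "\<dots> = (\<Sum>m\<in>S. \<Sum>k | k \<in> S \<and> m < k. - A m k)"
    by (intro sum.cong refl anti) auto
  finally show ?thesis
    by (simp add: sum_negf)
qed (simp add: d_def)

text \<open>
  In the quotient of two successive filtration steps, inserting \<open>3 * j + 1\<close> is always possible,
  because \<open>3 * j - 1\<close> is present and \<open>3 * j + 2\<close> is absent; so the quotient is a cone.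
\<close>

lemma filt_step:
  assumes n: "3 * j + 1 \<le> n" and z: "cochain i z" "filt j z" and dz: "filt (Suc j) (d z)"
  shows "\<exists>y. cochain (i - 1) y \<and> filt (Suc j) (\<lambda>S. z S - d y S)"
proof -
  let ?a = "3 * j + 1"
  let ?b = "3 * j + 2"
  \<comment> \<open>This is the contracting homotopy applied to \<open>z\<close>: it removes
    \<open>?a\<close> from the sets that contain it, restricted to sets without \<open>?b\<close>,
    that is, outside the next filtration step.\<close>
  define y where "y S = (if ?a \<notin> S \<and> ?b \<notin> S then s S ?a * z (insert ?a S) else 0)" for S
  have y_nz: "?a \<notin> S \<and> ?b \<notin> S \<and> z (insert ?a S) \<noteq> 0" if "y S \<noteq> 0" for S
    using that by (auto simp: y_def split: if_splits)
  have "cochain (i - 1) y"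
    unfolding cochain_def
  proof (intro allI impI)
    fix S assume "y S \<noteq> 0"
    from y_nz[OF this] have S: "?a \<notin> S" "sparse n (insert ?a S)" "int (card (insert ?a S)) = i"
      using z by (auto simp: cochain_def)
    moreover have "finite S" using sparse_finite[OF S(2)] by simp
    ultimately show "sparse n S \<and> int (card S) = i - 1"
      using sparse_subset[of n "insert ?a S" S] by auto
  qed
  moreover have filt_y: "filt j y"
    unfolding filt_def
  proof (intro allI impI)
    fix S l assume "y S \<noteq> 0" and l: "l < j"
    from y_nz[OF this(1)] have "3 * l + 2 \<in> insert ?a S"
      using z(2) l by (auto simp: filt_def)
    moreover have "3 * l + 2 \<noteq> ?a" by presburger
    ultimately show "3 * l + 2 \<in> S" by simp
  qed
  \<comment> \<open>This is the goal in contrapositive form: the difference must vanish on every set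
    that misses a required element.\<close>
  have "z S = d y S" if not_b: "\<not> (\<forall>l<Suc j. 3 * l + 2 \<in> S)" for S
  proof (cases "sparse n S \<and> (\<forall>l<j. 3 * l + 2 \<in> S)")
    case False
    moreover have "d y S \<noteq> 0 \<Longrightarrow> sparse n S"
      by (auto simp: d_def split: if_splits)
    ultimately show ?thesis
      using z filt_d[OF filt_y] unfolding cochain_def filt_def by metis
  next
    case True
    then have S: "sparse n S" and bS: "?b \<notin> S"
      using not_b by (auto simp: less_Suc_eq)
    note fin = sparse_finite[OF S]
    have dy: "d y S = (\<Sum>k\<in>S. s (S - {k}) k * y (S - {k}))"
      using S by (simp add: d_def)
    show ?thesis
    proof (cases "?a \<in> S")
      case aS: True
      \<comment> \<open>Removing any other element leaves \<open>?a\<close> in the set, where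
        \<open>y\<close> vanishes.\<close>
      have "d y S = s (S - {?a}) ?a * y (S - {?a})"
        unfolding dy using aS fin by (subst sum.remove[OF fin aS]) (auto simp: y_def intro!: sum.neutral)
      also have "\<dots> = z S"
        using aS bS sign_square[of "S - {?a}" ?a]
        by (simp add: y_def insert_absorb flip: mult.assoc)
      finally show ?thesis ..
    next
      case aS: False
      \<comment> \<open>For \<open>j = 0\<close> this number lies outside \<open>{1..n}\<close>;
        otherwise the required element \<open>3 * j - 1\<close> excludes it. With \<open>?b\<close>
        absent as well, \<open>?a\<close> has no neighbour in \<open>S\<close>.\<close>
      have "3 * j \<notin> S"
      proof (cases j)
        case (Suc l)
        then have "3 * l + 2 \<in> S" using True by blast
        then have "Suc (3 * l + 2) \<notin> S" using S by (auto simp: sparse_def)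
        moreover have "3 * j = Suc (3 * l + 2)" using Suc by simp
        ultimately show ?thesis by metis
      qed (use S in \<open>auto simp: sparse_def\<close>)
      then have aspar: "sparse n (insert ?a S)"
        using S bS n by (auto simp: sparse_def)
      \<comment> \<open>The hypothesis on \<open>d z\<close> applies because \<open>?b\<close> is
        missing. The vanishing sum is then solved for the summand that removes \<open>?a\<close>,
        which expresses \<open>z S\<close> by the values entering \<open>d y S\<close>.\<close>
      have "d z (insert ?a S) = 0"
      proof (rule ccontr)
        assume "d z (insert ?a S) \<noteq> 0"
        then have "?b \<in> insert ?a S" using dz unfolding filt_def by blast
        then show False using bS by simp
      qed
      then have "(\<Sum>k\<in>insert ?a S. s (insert ?a S - {k}) k * z (insert ?a S - {k})) = 0"
        using aspar by (simp add: d_def)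
      then have zS: "s S ?a * z S = - (\<Sum>k\<in>S. s (insert ?a S - {k}) k * z (insert ?a S - {k}))"
        using fin aS by (simp add: eq_neg_iff_add_eq_0)
      have "d y S = (\<Sum>k\<in>S. s (S - {k}) k * (s (S - {k}) ?a * z (insert ?a S - {k})))"
        unfolding dy
      proof (intro sum.cong refl)
        fix k assume "k \<in> S"
        then have "insert ?a (S - {k}) = insert ?a S - {k}" using aS by auto
        then show "s (S - {k}) k * y (S - {k}) =
            s (S - {k}) k * (s (S - {k}) ?a * z (insert ?a S - {k}))"
          using aS bS by (simp add: y_def)
      qed
      also have "\<dots> = (\<Sum>k\<in>S. - s S ?a * (s (insert ?a S - {k}) k * z (insert ?a S - {k})))"
      proof (intro sum.cong refl)
        fix k assume k: "k \<in> S"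
        let ?R = "S - {k}"
        have R: "insert k ?R = S" "insert ?a ?R = insert ?a S - {k}" "k \<noteq> ?a"
          using k aS by auto
        have "s ?R k * s S ?a = - (s ?R ?a * s (insert ?a S - {k}) k)"
        proof -
          have "?R \<subseteq> {1..n}" "k \<in> {1..n} - ?R" "?a \<in> {1..n} - ?R"
            using k aS S n by (auto simp: sparse_def)
          from sign_anticommute[OF this R(3)] show ?thesis
            unfolding R .
        qed
        \<comment> \<open>The factor \<open>s S ?a * s S ?a\<close>, which equals one, is inserted
          so that anticommutation can be applied.\<close>
        moreover have "s ?R k * s ?R ?a = s ?R k * s S ?a * (s S ?a * s ?R ?a)"
          using sign_square[of S ?a] by (simp add: mult_ac flip: mult.assoc[of "s S ?a" "s S ?a"])
        ultimately have "s ?R k * s ?R ?a =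
            - (s ?R ?a * s ?R ?a) * (s S ?a * s (insert ?a S - {k}) k)"
          by (simp add: mult_ac)
        then have "s ?R k * s ?R ?a = - s S ?a * s (insert ?a S - {k}) k"
          by (simp add: sign_square)
        then show "s ?R k * (s ?R ?a * z (insert ?a S - {k})) =
            - s S ?a * (s (insert ?a S - {k}) k * z (insert ?a S - {k}))"
          by (simp flip: mult.assoc)
      qed
      also have "\<dots> = s S ?a * (s S ?a * z S)"
        unfolding zS by (simp add: sum_distrib_left sum_negf)
      also have "\<dots> = z S"
        using sign_square[of S ?a] by (simp flip: mult.assoc)
      finally show ?thesis ..
    qed
  qed
  then have "filt (Suc j) (\<lambda>S. z S - d y S)"
    unfolding filt_def by (metis right_minus_eq)
  ultimately show ?thesis by blast
qed

text \<open>Subtracting a coboundary does not change \<open>d z\<close>, so \<open>filt_step\<close>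
  can be iterated. The bound on \<open>m\<close> says exactly that the last toggled element
  \<open>3 * (m - 1) + 1\<close> is at most \<open>n\<close>. Assuming only
  \<open>filt m (d z)\<close>, and not \<open>d z = 0\<close>, also covers a would-be preimage of
  the surviving class.\<close>

lemma push_into_filt:
  assumes n: "3 * m \<le> n + 2" and z: "cochain i z" and dz: "filt m (d z)"
  shows "\<exists>y. cochain (i - 1) y \<and> filt m (\<lambda>S. z S - d y S)"
  using n dz
proof (induction m)
  case 0
  show ?case by (intro exI[of _ "\<lambda>S. 0"]) (auto simp: cochain_def filt_def)
next
  case (Suc m)
  have "filt m (d z)" using Suc.prems(2) by (auto simp: filt_def)
  with Suc obtain y where y: "cochain (i - 1) y" "filt m (\<lambda>S. z S - d y S)"
    by auto
  let ?z = "\<lambda>S. z S - d y S"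
  have "cochain i ?z"
    using cochain_diff[OF z] cochain_d[OF y(1)] by simp
  moreover have "d ?z = d z"
    by (simp add: d_diff d_d fun_eq_iff)
  ultimately obtain y' where y': "cochain (i - 1) y'" "filt (Suc m) (\<lambda>S. ?z S - d y' S)"
    using filt_step[of m i ?z] y(2) Suc.prems by auto
  then show ?case
    using cochain_add[OF y(1) y'(1)]
    by (intro exI[of _ "\<lambda>S. y S + y' S"]) (simp add: d_add diff_diff_add)
qed

lemma acyclic:
  assumes "n mod 3 = 1" and z: "cochain i z" "d z = (\<lambda>S. 0)"
  shows "\<exists>y. cochain (i - 1) y \<and> d y = z"
proof -
  \<comment> \<open>For \<open>n = 3 * q + 1\<close> this step requires
    \<open>3 * q + 2 = n + 1\<close>, which lies outside \<open>{1..n}\<close>; hence it contains no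
    nonzero cochain.\<close>
  let ?m = "Suc (n div 3)"
  have "3 * ?m \<le> n + 2" using assms(1) by presburger
  then obtain y where y: "cochain (i - 1) y" "filt ?m (\<lambda>S. z S - d y S)"
    using push_into_filt z by (fastforce simp: filt_def)
  have "z S = d y S" for S
  proof (rule ccontr)
    assume ne: "z S \<noteq> d y S"
    then have "z S - d y S \<noteq> 0" by simp
    then have "3 * (n div 3) + 2 \<in> S"
      using y(2) unfolding filt_def by blast
    moreover have "sparse n S"
      using ne z by (auto simp: d_def cochain_def split: if_splits)
    ultimately have "3 * (n div 3) + 2 \<le> n" by (auto simp: sparse_def)
    then show False using assms(1) by presburger
  qed
  then have "d y = z" by (simp add: fun_eq_iff)
  then show ?thesis using y(1) by blast
qed

section \<open>The surviving class when \<open>n mod 3 \<noteq> 1\<close>\<close>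

definition critical :: "nat set" where
  "critical = (\<lambda>l. 3 * l + 2) ` {..<(n + 1) div 3}"

text \<open>This is the degree of the surviving class: \<open>3 * l + 2 \<le> n\<close> is
  equivalent to \<open>l < (n + 1) div 3\<close>.\<close>

lemma card_critical: "card critical = (n + 1) div 3"
  unfolding critical_def by (subst card_image) (auto simp: inj_on_def)

lemma sparse_critical: "sparse n critical"
  unfolding sparse_def critical_def by auto presburger+

text \<open>In a block \<open>{3 * l + 1, 3 * l + 2, 3 * l + 3}\<close> the middle element excludes
  the other two. The condition on \<open>n\<close> ensures that every block meeting
  \<open>{1..n}\<close> has its middle element there.\<close>

lemma sparse_eq_critical:
  assumes n: "n mod 3 \<noteq> 1" and S: "sparse n S" and sub: "\<forall>l<(n + 1) div 3. 3 * l + 2 \<in> S"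
  shows "S = critical"
proof
  show "critical \<subseteq> S" using sub by (auto simp: critical_def)
  show "S \<subseteq> critical"
  proof
    fix k assume k: "k \<in> S"
    define l where "l = (k - 1) div 3"
    have k1: "1 \<le> k" "k \<le> n" using k S by (auto simp: sparse_def)
    then have l: "l < (n + 1) div 3" using n unfolding l_def by presburger
    then have b: "3 * l + 2 \<in> S" using sub by blast
    define m where "m = (k - 1) mod 3"
    have "k = 3 * l + m + 1"
      using k1 by (simp add: l_def m_def)
    moreover have "m < 3" by (simp add: m_def)
    ultimately have "k = 3 * l + 1 \<or> k = 3 * l + 2 \<or> k = Suc (3 * l + 2)"
      by linarith
    moreover have "Suc (3 * l + 2) \<notin> S" "Suc k \<notin> S" using b k S by (auto simp: sparse_def)
    ultimately have "k = 3 * l + 2" using k b by auto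
    then show "k \<in> critical" using l by (auto simp: critical_def)
  qed
qed

definition generator :: "nat set \<Rightarrow> 'k" where
  "generator S = (if S = critical then 1 else 0)"

lemma cochain_generator: "cochain (int ((n + 1) div 3)) generator"
  by (simp add: cochain_def generator_def sparse_critical card_critical)

text \<open>The last filtration step is at most a line. The degree \<open>i\<close> is left free: a
  cochain of any degree other than that of \<open>critical\<close> vanishes there and is therefore
  zero.\<close>

lemma filt_eq_generator:
  assumes "n mod 3 \<noteq> 1" "cochain i f" "filt ((n + 1) div 3) f"
  shows "f S = f critical * generator S"
  using assms sparse_eq_critical unfolding generator_def cochain_def filt_def by (metis mult.right_neutral mult_zero_right)

lemma filt_generator: "filt ((n + 1) div 3) generator"
  by (auto simp: filt_def generator_def critical_def)

text \<open>The differential stays in the last filtration step but raises the degree by one, away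
  from the only degree in which that step is nonzero.\<close>

lemma d_generator:
  assumes "n mod 3 \<noteq> 1"
  shows "d generator = (\<lambda>S. 0)"
proof -
  have c: "cochain (int ((n + 1) div 3) + 1) (d generator)"
    by (rule cochain_d[OF cochain_generator])
  then have "d generator critical = 0"
    by (auto simp: cochain_def card_critical)
  then show ?thesis
    using filt_eq_generator[OF assms c filt_d[OF filt_generator]] by (metis mult_zero_left)
qed

text \<open>The coefficient \<open>c\<close> is the value at \<open>critical\<close> of the cocycle
  after it has been pushed into the last filtration step.\<close>

lemma cocycle_eq:
  assumes n: "n mod 3 \<noteq> 1" and z: "cochain i z" "d z = (\<lambda>S. 0)"
  shows "\<exists>c y. cochain (i - 1) y \<and> z = (\<lambda>S. c * generator S + d y S) \<and>
           (i \<noteq> int ((n + 1) div 3) \<longrightarrow> c = 0)"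
proof -
  let ?m = "(n + 1) div 3"
  have "3 * ?m \<le> n + 2" by presburger
  then obtain y where y: "cochain (i - 1) y" "filt ?m (\<lambda>S. z S - d y S)"
    using push_into_filt z by (fastforce simp: filt_def)
  let ?z = "\<lambda>S. z S - d y S"
  have zc: "cochain i ?z" using cochain_diff[OF z(1)] cochain_d[OF y(1)] by simp
  have "?z S = ?z critical * generator S" for S
    by (rule filt_eq_generator[OF n zc y(2)])
  then have "z = (\<lambda>S. ?z critical * generator S + d y S)"
    by (metis (no_types, lifting) ext diff_add_cancel)
  moreover have "i \<noteq> int ?m \<longrightarrow> ?z critical = 0"
    using zc by (auto simp: cochain_def card_critical)
  ultimately show ?thesis using y(1) by blast
qed

text \<open>A preimage could itself be pushed into the last filtration step, since its differential
  lies there. Its degree is one too low for that step, so it would become zero while its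
  differential remained \<open>generator\<close>.\<close>

lemma generator_not_coboundary:
  assumes n: "n mod 3 \<noteq> 1" and y: "cochain (int ((n + 1) div 3) - 1) y"
  shows "d y \<noteq> generator"
proof
  assume dy: "d y = generator"
  let ?m = "(n + 1) div 3"
  have "3 * ?m \<le> n + 2" by presburger
  then obtain x where x: "cochain (int ?m - 1 - 1) x" "filt ?m (\<lambda>S. y S - d x S)"
    using push_into_filt[OF _ y] filt_generator dy by auto
  let ?z = "\<lambda>S. y S - d x S"
  have zc: "cochain (int ?m - 1) ?z" using cochain_diff[OF y] cochain_d[OF x(1)] by simp
  then have "?z critical = 0" by (auto simp: cochain_def card_critical)
  then have "?z = (\<lambda>S. 0)" using filt_eq_generator[OF n zc x(2)] by (metis mult_zero_left)
  then have "d ?z critical = 0" by (simp add: d_def)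
  then show False by (simp add: d_diff d_d dy generator_def)
qed

end

section \<open>Multipaths of alternating linear graphs\<close>

text \<open>Components are general digraphs with their own \<open>tail\<close> and
  \<open>head\<close>; compatibility forces these to be the projections, so a component can be
  treated as a set of pairs.\<close>

lemma subgraph_with_projE:
  assumes "subgraph C (with_proj H)"
  obtains D where "C = with_proj D" "pverts D \<subseteq> pverts H" "parcs D \<subseteq> parcs H"
    "pair_wf_digraph D"
proof
  have "tail C = fst" "head C = snd"
    using assms by (auto simp: subgraph_def compatible_def)
  then show C: "C = with_proj \<lparr>pverts = verts C, parcs = arcs C\<rparr>"
    by (simp add: with_proj_def)
  show "pair_wf_digraph \<lparr>pverts = verts C, parcs = arcs C\<rparr>"
    using assms C by (metis subgraph_def wf_digraph_wp_iff)
qed (use assms in \<open>auto simp: subgraph_def\<close>)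

lemma subgraph_with_projI:
  assumes "pverts D \<subseteq> pverts H" "parcs D \<subseteq> parcs H" "pair_wf_digraph D" "pair_wf_digraph H"
  shows "subgraph (with_proj D) (with_proj H)"
  using assms by (auto simp: subgraph_def compatible_def wf_digraph_wp_iff)

section \<open>Connectedness, simple paths and matchings\<close>

lemma connected_with_proj:
  "connected (with_proj D) \<longleftrightarrow>
    pverts D \<noteq> {} \<and>
    (\<forall>u\<in>pverts D. \<forall>w\<in>pverts D. (u, w) \<in> rtrancl_on (pverts D) (parcs D \<union> (parcs D)\<inverse>))"
proof -
  have "parcs (mk_symmetric (with_proj D)) = parcs D \<union> (parcs D)\<inverse>"
    by (auto simp: parcs_mk_symmetric)
  then show ?thesis
    by (simp add: connected_def strongly_connected_def reachable_def)
qed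

text \<open>Through these two forms, distinct vertices on a walk yield both distinct heads and
  distinct tails of its arcs.\<close>

lemma pcas_awalk_verts:
  assumes "pcas u p w"
  shows "pawalk_verts u p = u # map snd p" "pawalk_verts u p = map fst p @ [w]"
  using assms by (induction p arbitrary: u) auto

lemma apath_with_proj:
  "pre_digraph.apath (with_proj D) u p w \<longleftrightarrow>
    u \<in> pverts D \<and> set p \<subseteq> parcs D \<and> pcas u p w \<and> distinct (pawalk_verts u p)"
  by (simp add: pre_digraph.apath_def pre_digraph.awalk_def cas_with_proj_eq
      awalk_verts_with_proj_eq)

text \<open>This is the notion of a matching.\<close>

definition arcs_disjoint :: "('a \<times> 'a) set \<Rightarrow> bool" where
  "arcs_disjoint A \<longleftrightarrow>
    (\<forall>a\<in>A. \<forall>b\<in>A. a \<noteq> b \<longrightarrow> {fst a, snd a} \<inter> {fst b, snd b} = {})"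

text \<open>From the ends of an arc no further arc can be entered, so a connected matching is a
  single vertex or a single arc.\<close>

lemma simple_path_if_disjoint:
  assumes disj: "arcs_disjoint (parcs D)" and loopfree: "\<forall>e\<in>parcs D. fst e \<noteq> snd e"
    and wf: "pair_wf_digraph D" and conn: "connected (with_proj D)"
  shows "is_simple_path (with_proj D)"
proof (cases "parcs D = {}")
  case True
  obtain u where u: "u \<in> pverts D"
    using conn by (auto simp: connected_with_proj)
  have "w = u" if "w \<in> pverts D" for w
  proof -
    have "(u, w) \<in> rtrancl_on (pverts D) {}"
      using conn u that True by (auto simp: connected_with_proj)
    then show ?thesis by induction auto
  qed
  then have "pverts D = {u}" using u by blast
  then show ?thesis
    unfolding is_simple_path_def apath_with_proj awalk_verts_with_proj_eq
    by (intro exI[of _ u] exI[of _ "[]"]) (auto simp: True)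
next
  case False
  then obtain u v where e: "(u, v) \<in> parcs D" by auto
  have uv: "u \<in> pverts D" "v \<in> pverts D" "u \<noteq> v"
    using e wf loopfree pair_wf_digraph.in_arcsD1 pair_wf_digraph.in_arcsD2 by fastforce+
  have only: "a = (u, v)" if "a \<in> parcs D" "fst a \<in> {u, v} \<or> snd a \<in> {u, v}" for a
    using disj e that unfolding arcs_disjoint_def by fastforce
  have "w \<in> {u, v}" if "w \<in> pverts D" for w
  proof -
    have "(u, w) \<in> rtrancl_on (pverts D) (parcs D \<union> (parcs D)\<inverse>)"
      using conn uv that by (auto simp: connected_with_proj)
    then show ?thesis
    proof (induction rule: rtrancl_on_induct)
      case (step x y)
      then have "x \<in> {u, v}" and "(x, y) \<in> parcs D \<or> (y, x) \<in> parcs D"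
        by blast+
      then have "(x, y) = (u, v) \<or> (y, x) = (u, v)"
        using only[of "(x, y)"] only[of "(y, x)"] by fastforce
      then show ?case by blast
    qed simp
  qed
  then have V: "pverts D = {u, v}" using uv by blast
  have "a = (u, v)" if "a \<in> parcs D" for a
    by (intro only[OF that] disjI1) (use pair_wf_digraph.arc_fst_in_verts[OF wf that] V in simp)
  then have "parcs D = {(u, v)}" using e by blast
  with V uv show ?thesis
    unfolding is_simple_path_def apath_with_proj awalk_verts_with_proj_eq
    by - (rule exI[of _ u], rule exI[of _ "[(u, v)]"], rule exI[of _ v], simp)
qed

text \<open>The definition of a multipath constrains maximal connected subgraphs only. To exploit
  it, a small connected subgraph must be enlarged to a maximal one, chosen here with the most
  vertices and arcs.\<close>

lemma max_connected_subgraph_exists: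
  assumes wf: "pair_wf_digraph H" and fin: "finite (pverts H)" "finite (parcs H)"
    and C: "subgraph C (with_proj H)" "connected C"
  obtains M where "pre_digraph.max_subgraph (with_proj H) connected M" "subgraph C M"
proof -
  let ?P = "\<lambda>M. subgraph M (with_proj H) \<and> connected M \<and> subgraph C M"
  let ?size = "\<lambda>M. card (verts M) + card (arcs M)"
  have bound: "card (verts M) \<le> card (pverts H)" "card (arcs M) \<le> card (parcs H)"
    if "subgraph M (with_proj H)" for M
    using that fin by (auto simp: subgraph_def intro: card_mono)
  have "subgraph C C" using C by (auto simp: subgraph_def compatible_def)
  then have "?P C" using C by blast
  then obtain M where M: "?P M" and greatest: "\<And>M'. ?P M' \<Longrightarrow> ?size M' \<le> ?size M"
    using ex_has_greatest_nat[of ?P C ?size "card (pverts H) + card (parcs H) + 1"] bound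
    by (metis (no_types, lifting) add_mono less_Suc_eq_le Suc_eq_plus1)
  have "pre_digraph.max_subgraph (with_proj H) connected M"
  proof (rule pre_digraph.max_subgraphI)
    fix M' assume M': "M \<noteq> M'" "subgraph M M'" "subgraph M' (with_proj H)"
    show "\<not> connected M'"
    proof
      assume "connected M'"
      moreover have "subgraph C M'"
        using M M'(2) by (auto simp: subgraph_def compatible_def)
      ultimately have le: "?size M' \<le> ?size M"
        using greatest M' by blast
      have sub: "verts M \<subseteq> verts M'" "arcs M \<subseteq> arcs M'" "tail M = tail M'" "head M = head M'"
        using M'(2) by (auto simp: subgraph_def compatible_def)
      have finM': "finite (verts M')" "finite (arcs M')"
        using M'(3) fin by (auto simp: subgraph_def intro: finite_subset)
      have "card (verts M) \<le> card (verts M')" "card (arcs M) \<le> card (arcs M')"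
        using sub finM' by (auto intro: card_mono)
      then have "card (verts M) = card (verts M')" "card (arcs M) = card (arcs M')"
        using le by auto
      then have "verts M = verts M'" "arcs M = arcs M'"
        using card_subset_eq[OF finM'(1) sub(1)] card_subset_eq[OF finM'(2) sub(2)] by auto
      then show False
        using M'(1) sub by (auto intro: pre_digraph.equality)
    qed
  qed (use M in auto)
  then show thesis using M that by blast
qed

text \<open>Two arcs with a common head or tail form a connected subgraph and so lie in one
  component. A simple path has no two arcs with the same head, nor two with the same tail.\<close>

lemma multipath_adjacent_arcs:
  assumes H: "multipath G H" and fin: "finite (pverts H)" "finite (parcs H)"
    and ab: "a \<in> parcs H" "b \<in> parcs H" and common: "fst a = fst b \<or> snd a = snd b"
  shows "a = b"
proof -
  have wf: "pair_wf_digraph H"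
    using H by (auto simp: multipath_def spanning_def subgraph_def wf_digraph_wp_iff)
  define D where "D = \<lparr>pverts = {fst a, snd a, fst b, snd b}, parcs = {a, b}\<rparr>"
  define R where "R = rtrancl_on (pverts D) (parcs D \<union> (parcs D)\<inverse>)"
  have "pair_wf_digraph D"
    by unfold_locales (auto simp: D_def)
  moreover have "pverts D \<subseteq> pverts H"
    using ab wf by (auto simp: D_def pair_wf_digraph.arc_fst_in_verts pair_wf_digraph.arc_snd_in_verts)
  ultimately have D: "subgraph (with_proj D) (with_proj H)"
    using wf ab by (intro subgraph_with_projI) (auto simp: D_def)
  have step: "(x, y) \<in> R" if "(x, y) \<in> parcs D \<or> (y, x) \<in> parcs D" for x y
    unfolding R_def by (rule rtrancl_on_into_rtrancl_on[OF rtrancl_on_refl]) (use that in \<open>auto simp: D_def\<close>)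
  have trans: "(x, z) \<in> R" if "(x, y) \<in> R" "(y, z) \<in> R" for x y z
    using that unfolding R_def by (rule rtrancl_on_trans)
  have refl: "(x, x) \<in> R" if "x \<in> pverts D" for x
    using that unfolding R_def by (rule rtrancl_on_refl)
  have steps: "(fst a, snd a) \<in> R" "(snd a, fst a) \<in> R" "(fst b, snd b) \<in> R" "(snd b, fst b) \<in> R"
    by (rule step, simp add: D_def)+
  \<comment> \<open>\<open>c\<close> is the shared end of the two arcs; any two vertices of
    \<open>D\<close> are connected through it.\<close>
  obtain c where c: "\<forall>x\<in>pverts D. (x, c) \<in> R \<and> (c, x) \<in> R"
  proof (cases "fst a = fst b")
    case True
    then show ?thesis
      using steps refl[of "fst a"] that[of "fst a"] by (simp add: D_def)
  next
    case False
    then have "snd a = snd b" using common by blast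
    then show ?thesis
      using steps refl[of "snd a"] that[of "snd a"] by (simp add: D_def)
  qed
  have "(x, y) \<in> R" if "x \<in> pverts D" "y \<in> pverts D" for x y
    using c that trans[of x c y] by blast
  moreover have "pverts D \<noteq> {}" by (simp add: D_def)
  ultimately have "connected (with_proj D)"
    unfolding connected_with_proj R_def[symmetric] by blast
  from max_connected_subgraph_exists[OF wf fin D this]
  obtain M where M: "pre_digraph.max_subgraph (with_proj H) connected M" "subgraph (with_proj D) M"
    by blast
  then have path: "is_simple_path M" using H by (auto simp: multipath_def)
  have "subgraph M (with_proj H)" using M(1) by (simp add: pre_digraph.max_subgraph_def)
  then obtain D' where D': "M = with_proj D'" by (rule subgraph_with_projE)
  from path obtain u p w where p: "pcas u p w" "distinct (pawalk_verts u p)" "parcs D' = set p"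
    unfolding is_simple_path_def D' apath_with_proj by (auto simp: awalk_verts_with_proj_eq)
  have "distinct (map fst p)" "distinct (map snd p)"
    using p(2) by (simp add: pcas_awalk_verts(2)[OF p(1)], simp add: pcas_awalk_verts(1)[OF p(1)])
  moreover have "a \<in> set p" "b \<in> set p"
    using M(2) p(3) by (auto simp: D' D_def subgraph_def)
  ultimately show ?thesis
    using common by (auto simp: distinct_map inj_on_def)
qed

text \<open>Alternation makes a vertex shared by two arcs the tail of both or the head of both,
  which a multipath forbids. Conversely, the components of a matching are paths with at most one
  arc.\<close>

lemma multipath_iff_disjoint:
  assumes fin: "finite (pverts G)" "finite (parcs G)" and wf: "pair_wf_digraph G"
    and loopfree: "\<forall>e\<in>parcs G. fst e \<noteq> snd e" and alt: "alternating G"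
  shows "multipath G H \<longleftrightarrow>
    pverts H = pverts G \<and> parcs H \<subseteq> parcs G \<and> arcs_disjoint (parcs H)"
    (is "_ \<longleftrightarrow> ?R")
proof
  assume H: "multipath G H"
  then have sub: "pverts H = pverts G" "parcs H \<subseteq> parcs G"
    by (auto simp: multipath_def spanning_def subgraph_def)
  have finH: "finite (pverts H)" "finite (parcs H)"
    using sub fin finite_subset by auto
  have "a = b" if ab: "a \<in> parcs H" "b \<in> parcs H" and x: "x \<in> {fst a, snd a}" "x \<in> {fst b, snd b}"
    for a b x
  proof (rule multipath_adjacent_arcs[OF H finH ab])
    have "x \<in> pverts G"
      using x ab sub wf pair_wf_digraph.arc_fst_in_verts pair_wf_digraph.arc_snd_in_verts by blast
    then have "x = fst a \<and> x = fst b \<or> x = snd a \<and> x = snd b"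
      using alt ab x sub unfolding alternating_def by blast
    then show "fst a = fst b \<or> snd a = snd b" by blast
  qed
  then show ?R using sub unfolding arcs_disjoint_def by blast
next
  assume R: ?R
  have wfH: "pair_wf_digraph H"
    using R wf by (metis pair_wf_digraph_def subsetD)
  show "multipath G H"
    unfolding multipath_def
  proof (intro conjI allI impI)
    show "spanning (with_proj H) (with_proj G)"
      using R wf wfH by (auto simp: spanning_def intro: subgraph_with_projI)
  next
    fix C assume "pre_digraph.max_subgraph (with_proj H) connected C"
    then have C: "subgraph C (with_proj H)" "connected C"
      by (auto simp: pre_digraph.max_subgraph_def)
    from C(1) obtain D where D: "C = with_proj D" "parcs D \<subseteq> parcs H" "pair_wf_digraph D"
      by (rule subgraph_with_projE)
    moreover have "arcs_disjoint (parcs D)"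
      using R D(2) unfolding arcs_disjoint_def by blast
    moreover have "\<forall>e\<in>parcs D. fst e \<noteq> snd e"
      using R D(2) loopfree by blast
    ultimately show "is_simple_path C"
      using C(2) by (simp add: simple_path_if_disjoint)
  qed
qed

text \<open>The edges are numbered along the path, \<open>e i\<close> joining
  \<open>v (i - 1)\<close> and \<open>v i\<close>. Two edges then meet exactly when their numbers
  differ by at most one, which turns matchings into sparse sets.\<close>

lemma alternating_linear_graph:
  assumes "is_A n G"
  obtains e where "bij_betw e {1..n} (parcs G)"
    "\<And>H. multipath G H \<longleftrightarrow> (\<exists>S. sparse n S \<and> H = \<lparr>pverts = pverts G, parcs = e ` S\<rparr>)"
proof -
  from assms obtain v where v: "bij_betw v {..<n + 1} (pverts G)"
    and one: "\<And>i. i \<in> {1..<n + 1} \<Longrightarrow> ((v i, v (i - 1)) \<in> parcs G) \<noteq> ((v (i - 1), v i) \<in> parcs G)"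
    and arcs: "\<And>a. a \<in> parcs G \<Longrightarrow> \<exists>i\<in>{1..<n + 1}. a = (v i, v (i - 1)) \<or> a = (v (i - 1), v i)"
    and alt: "alternating G"
    unfolding is_A_def oriented_linear_graph_def by metis
  \<comment> \<open>Exactly one of the two directions is present, so for
    \<open>i \<in> {1..n}\<close> the \<open>else\<close> branch also yields an arc of
    \<open>G\<close>.\<close>
  define e where "e i = (if (v i, v (i - 1)) \<in> parcs G then (v i, v (i - 1)) else (v (i - 1), v i))" for i
  have e_arc: "e i \<in> parcs G" if "i \<in> {1..n}" for i
    using one[of i] that by (auto simp: e_def)
  have ends: "{fst (e i), snd (e i)} = {v (i - 1), v i}" for i
    by (auto simp: e_def)
  have v_inj: "v i = v j \<longleftrightarrow> i = j" if "i \<le> n" "j \<le> n" for i j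
    using bij_betw_imp_inj_on[OF v] that by (auto simp: inj_on_def)
  have meet: "{fst (e i), snd (e i)} \<inter> {fst (e j), snd (e j)} \<noteq> {} \<longleftrightarrow> i = j \<or> i = Suc j \<or> j = Suc i"
    if "i \<in> {1..n}" "j \<in> {1..n}" for i j
  proof -
    have "{v (i - 1), v i} \<inter> {v (j - 1), v j} \<noteq> {} \<longleftrightarrow>
        i - 1 = j - 1 \<or> i - 1 = j \<or> i = j - 1 \<or> i = j"
      using that v_inj by auto
    also have "\<dots> \<longleftrightarrow> i = j \<or> i = Suc j \<or> j = Suc i"
      using that by auto
    finally show ?thesis unfolding ends .
  qed
  have "inj_on e {1..n}"
  proof (rule inj_onI)
    fix i j assume ij: "i \<in> {1..n}" "j \<in> {1..n}" and "e i = e j"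
    then have "{v (i - 1), v i} = {v (j - 1), v j}" using ends by metis
    moreover have "v (i - 1) \<noteq> v i" "v (j - 1) \<noteq> v j" using v_inj ij by auto
    ultimately have "v (i - 1) = v (j - 1) \<or> v (i - 1) = v j \<and> v i = v (j - 1)"
      by (auto simp: doubleton_eq_iff)
    then show "i = j" using v_inj ij by auto
  qed
  moreover have "parcs G \<subseteq> e ` {1..n}"
  proof
    fix a assume a: "a \<in> parcs G"
    then obtain i where i: "i \<in> {1..n}" "a = (v i, v (i - 1)) \<or> a = (v (i - 1), v i)"
      using arcs by fastforce
    then have "a = e i" using a one[of i] by (auto simp: e_def)
    then show "a \<in> e ` {1..n}" using i by blast
  qed
  ultimately have bij: "bij_betw e {1..n} (parcs G)"
    using e_arc by (auto simp: bij_betw_def)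
  have fin: "finite (pverts G)" "finite (parcs G)"
    using bij_betw_finite[OF v] bij_betw_finite[OF bij] by auto
  have arcE: "\<exists>i\<in>{1..n}. a = e i" if "a \<in> parcs G" for a
    using that bij by (auto simp: bij_betw_def)
  have vV: "v i \<in> pverts G" if "i \<le> n" for i
    using v that by (auto simp: bij_betw_def)
  have "fst a \<in> pverts G \<and> snd a \<in> pverts G \<and> fst a \<noteq> snd a" if a: "a \<in> parcs G" for a
  proof -
    obtain i where i: "i \<in> {1..n}" "a = e i" using arcE a by blast
    moreover from i(1) have "i \<le> n" "i - 1 \<le> n" "i \<noteq> i - 1" by auto
    ultimately show ?thesis
      using vV[of i] vV[of "i - 1"] v_inj[of i "i - 1"] unfolding e_def by (metis fst_conv snd_conv)
  qed
  then have wf: "pair_wf_digraph G" and loopfree: "\<forall>a\<in>parcs G. fst a \<noteq> snd a"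
    by (auto simp: pair_wf_digraph_def)
  have disjoint: "arcs_disjoint (e ` S) \<longleftrightarrow> sparse n S" if S: "S \<subseteq> {1..n}" for S
  proof -
    have e_eq: "e i = e j \<longleftrightarrow> i = j" if "i \<in> S" "j \<in> S" for i j
      using bij_betw_imp_inj_on[OF bij] that S by (meson inj_onD subsetD)
    have "arcs_disjoint (e ` S) \<longleftrightarrow>
        (\<forall>i\<in>S. \<forall>j\<in>S. i \<noteq> j \<longrightarrow> {fst (e i), snd (e i)} \<inter> {fst (e j), snd (e j)} = {})"
      unfolding arcs_disjoint_def by (simp add: e_eq cong: ball_cong_simp)
    also have "\<dots> \<longleftrightarrow> (\<forall>i\<in>S. \<forall>j\<in>S. i \<noteq> j \<longrightarrow> i \<noteq> Suc j \<and> j \<noteq> Suc i)"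
    proof (intro ball_cong refl)
      fix i j assume "i \<in> S" "j \<in> S"
      then have "i \<in> {1..n}" "j \<in> {1..n}" using S by auto
      from meet[OF this]
      show "(i \<noteq> j \<longrightarrow> {fst (e i), snd (e i)} \<inter> {fst (e j), snd (e j)} = {}) \<longleftrightarrow>
          (i \<noteq> j \<longrightarrow> i \<noteq> Suc j \<and> j \<noteq> Suc i)"
        by metis
    qed
    also have "\<dots> \<longleftrightarrow> sparse n S"
      using S unfolding sparse_def by (metis n_not_Suc_n)
    finally show ?thesis .
  qed
  have "multipath G H \<longleftrightarrow> (\<exists>S. sparse n S \<and> H = \<lparr>pverts = pverts G, parcs = e ` S\<rparr>)" for H
  proof -
    have "multipath G H \<longleftrightarrow> pverts H = pverts G \<and> parcs H \<subseteq> parcs G \<and> arcs_disjoint (parcs H)"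
      by (rule multipath_iff_disjoint[OF fin wf loopfree alt])
    also have "\<dots> \<longleftrightarrow> (\<exists>S. sparse n S \<and> H = \<lparr>pverts = pverts G, parcs = e ` S\<rparr>)"
    proof
      assume L: "pverts H = pverts G \<and> parcs H \<subseteq> parcs G \<and> arcs_disjoint (parcs H)"
      then obtain S where S: "S \<subseteq> {1..n}" "parcs H = e ` S"
        using bij unfolding bij_betw_def by (metis subset_imageE)
      then show "\<exists>S. sparse n S \<and> H = \<lparr>pverts = pverts G, parcs = e ` S\<rparr>"
        using L disjoint[OF S(1)] by (intro exI[of _ S]) auto
    next
      assume "\<exists>S. sparse n S \<and> H = \<lparr>pverts = pverts G, parcs = e ` S\<rparr>"
      then show "pverts H = pverts G \<and> parcs H \<subseteq> parcs G \<and> arcs_disjoint (parcs H)"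
        using disjoint e_arc unfolding sparse_def by (fastforce simp: sparse_def)
    qed
    finally show ?thesis .
  qed
  then show thesis using that bij by blast
qed

section \<open>Quotients of dimension at most one\<close>

definition subspace :: "('v \<Rightarrow> 'k::field) set \<Rightarrow> bool" where
  "subspace B \<longleftrightarrow> 0 \<in> B \<and> (\<forall>x\<in>B. \<forall>y\<in>B. x + y \<in> B) \<and> (\<forall>c. \<forall>x\<in>B. scale c x \<in> B)"

lemma subspaceD:
  assumes "subspace B"
  shows "0 \<in> B" "x \<in> B \<Longrightarrow> y \<in> B \<Longrightarrow> x + y \<in> B" "x \<in> B \<Longrightarrow> scale c x \<in> B"
    "x \<in> B \<Longrightarrow> y \<in> B \<Longrightarrow> x - y \<in> B"
proof -
  show "0 \<in> B" "x \<in> B \<Longrightarrow> y \<in> B \<Longrightarrow> x + y \<in> B" "x \<in> B \<Longrightarrow> scale c x \<in> B"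
    using assms by (auto simp: subspace_def)
  assume "x \<in> B" "y \<in> B"
  then have "x + scale (- 1) y \<in> B" using assms by (auto simp: subspace_def)
  moreover have "x + scale (- 1) y = x - y" by (auto simp: scale_def)
  ultimately show "x - y \<in> B" by simp
qed

lemma scale_simps:
  "scale c (x + y) = scale c x + scale c y" "scale (a + b) x = scale a x + scale b x"
  "scale (a - b) x = scale a x - scale b x" "scale a (scale b x) = scale (a * b) x"
  "scale 1 x = x" "scale 0 x = 0" "scale c 0 = 0"
  by (auto simp: scale_def algebra_simps)

section \<open>Cosets and quotients generated by one class\<close>

definition coset :: "('v \<Rightarrow> 'k::field) set \<Rightarrow> ('v \<Rightarrow> 'k) \<Rightarrow> ('v \<Rightarrow> 'k) set" where
  "coset B x = {x + y | y. y \<in> B}"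

lemma coset_eq_iff:
  assumes B: "subspace B"
  shows "coset B x = coset B x' \<longleftrightarrow> x - x' \<in> B"
proof
  assume "coset B x = coset B x'"
  moreover have "x \<in> coset B x" unfolding coset_def using subspaceD(1)[OF B] by force
  ultimately obtain y where "y \<in> B" "x = x' + y" unfolding coset_def by blast
  then show "x - x' \<in> B" by simp
next
  assume xx': "x - x' \<in> B"
  have "x' - x \<in> B"
    using subspaceD(4)[OF B subspaceD(1)[OF B] xx'] by simp
  have "x + y \<in> coset B x'" if "y \<in> B" for y
    unfolding coset_def using subspaceD(2)[OF B xx' that]
    by (intro CollectI exI[of _ "x - x' + y"]) simp
  moreover have "x' + y \<in> coset B x" if "y \<in> B" for y
    unfolding coset_def using subspaceD(2)[OF B \<open>x' - x \<in> B\<close> that]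
    by (intro CollectI exI[of _ "x' - x + y"]) simp
  ultimately show "coset B x = coset B x'"
    by (auto simp: coset_def)
qed

lemma coset_zero: "coset B 0 = B"
  by (auto simp: coset_def)

lemma coset_add:
  assumes B: "subspace B"
  shows "{x + y | x y. x \<in> coset B u \<and> y \<in> coset B w} = coset B (u + w)"
proof (intro equalityI subsetI)
  fix v assume "v \<in> {x + y | x y. x \<in> coset B u \<and> y \<in> coset B w}"
  then obtain a b where ab: "a \<in> B" "b \<in> B" "v = u + a + (w + b)"
    by (auto simp: coset_def)
  then show "v \<in> coset B (u + w)"
    unfolding coset_def using subspaceD(2)[OF B ab(1,2)]
    by (intro CollectI exI[of _ "a + b"]) (simp add: add_ac)
next
  fix v assume "v \<in> coset B (u + w)"
  then obtain a where "a \<in> B" "v = u + 0 + (w + a)"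
    by (auto simp: coset_def add_ac)
  then show "v \<in> {x + y | x y. x \<in> coset B u \<and> y \<in> coset B w}"
    unfolding coset_def using subspaceD(1)[OF B] by blast
qed

lemma coset_scale:
  assumes B: "subspace B"
  shows "{scale c x + y | x y. x \<in> coset B u \<and> y \<in> B} = coset B (scale c u)"
proof (intro equalityI subsetI)
  fix v assume "v \<in> {scale c x + y | x y. x \<in> coset B u \<and> y \<in> B}"
  then obtain a b where ab: "a \<in> B" "b \<in> B" "v = scale c (u + a) + b"
    by (auto simp: coset_def)
  then show "v \<in> coset B (scale c u)"
    unfolding coset_def using subspaceD(2)[OF B subspaceD(3)[OF B ab(1)] ab(2)]
    by (intro CollectI exI[of _ "scale c a + b"]) (simp add: scale_simps add_ac)
next
  fix v assume "v \<in> coset B (scale c u)"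
  then obtain a where "a \<in> B" "v = scale c (u + 0) + a"
    by (auto simp: coset_def)
  then show "v \<in> {scale c x + y | x y. x \<in> coset B u \<and> y \<in> B}"
    unfolding coset_def using subspaceD(1)[OF B] by blast
qed

text \<open>For a subspace \<open>B\<close>, the quotient by \<open>B\<close> is zero if
  \<open>z \<in> B\<close> and a line otherwise. One form thus describes the cocycles in every
  degree.\<close>

definition span_mod :: "('v \<Rightarrow> 'k::field) \<Rightarrow> ('v \<Rightarrow> 'k) set \<Rightarrow> ('v \<Rightarrow> 'k) set" where
  "span_mod z B = {scale c z + y | c y. y \<in> B}"

lemma carrier_quotient_span_mod:
  assumes B: "subspace B"
  shows "carrier (quotient_space (span_mod z B) B) = range (\<lambda>c. coset B (scale c z))"
proof -
  have "carrier (quotient_space (span_mod z B) B) = coset B ` span_mod z B"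
    by (auto simp: quotient_space_def coset_def)
  also have "\<dots> = range (\<lambda>c. coset B (scale c z))"
  proof -
    have "coset B (scale c z + y) = coset B (scale c z)" if "y \<in> B" for c y
      using that by (simp add: coset_eq_iff[OF B])
    moreover have "scale c z \<in> span_mod z B" for c
      unfolding span_mod_def using subspaceD(1)[OF B] by force
    ultimately show ?thesis
      unfolding span_mod_def by (fastforce simp: image_def)
  qed
  finally show ?thesis .
qed

text \<open>Either both quotients are zero or both are lines. In both cases, sending the class of
  \<open>scale c z\<close> to that of \<open>scale c z'\<close> is well defined and
  injective.\<close>

lemma quotient_span_mod_iso:
  fixes B :: "('v \<Rightarrow> 'k::field) set" and B' :: "('w \<Rightarrow> 'k) set"
  assumes B: "subspace B" and B': "subspace B'" and zz': "z \<in> B \<longleftrightarrow> z' \<in> B'"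
  shows "quotient_space (span_mod z B) B \<cong>\<^sub>l\<^sub>i\<^sub>n quotient_space (span_mod z' B') B'"
proof -
  let ?Q = "quotient_space (span_mod z B) B"
  let ?Q' = "quotient_space (span_mod z' B') B'"
  note carrier = carrier_quotient_span_mod[OF B, of z] carrier_quotient_span_mod[OF B', of z']
  have scale_in: "scale c x \<in> A \<longleftrightarrow> c = 0 \<or> x \<in> A" if "subspace A" for c x and A :: "('u \<Rightarrow> 'k) set"
    using subspaceD(1)[OF that] subspaceD(3)[OF that, where x = x and c = c]
      subspaceD(3)[OF that, where x = "scale c x" and c = "inverse c"]
    by (cases "c = 0") (auto simp: scale_simps)
  have eq: "coset B (scale a z) = coset B (scale b z) \<longleftrightarrow>
      coset B' (scale a z') = coset B' (scale b z')" for a b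
    using zz' scale_in[OF B, of "a - b" z] scale_in[OF B', of "a - b" z']
    by (simp add: coset_eq_iff[OF B] coset_eq_iff[OF B'] scale_simps)
  \<comment> \<open>The coefficient of a coset is not unique when \<open>z \<in> B\<close>; by
    \<open>eq\<close> the choice does not affect the value.\<close>
  define h where "h X = coset B' (scale (SOME c. X = coset B (scale c z)) z')" for X
  have h: "h (coset B (scale c z)) = coset B' (scale c z')" for c
  proof -
    have "coset B (scale c z) = coset B (scale (SOME a. coset B (scale c z) = coset B (scale a z)) z)"
      by (rule someI) (rule refl)
    then show ?thesis unfolding h_def using eq by metis
  qed
  have add: "coset B (scale a z) \<oplus>\<^bsub>?Q\<^esub> coset B (scale b z) = coset B (scale (a + b) z)" for a b
    by (simp add: quotient_space_def coset_add[OF B] scale_simps)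
  have add': "coset B' (scale a z') \<oplus>\<^bsub>?Q'\<^esub> coset B' (scale b z') = coset B' (scale (a + b) z')" for a b
    by (simp add: quotient_space_def coset_add[OF B'] scale_simps)
  have smult: "c \<odot>\<^bsub>?Q\<^esub> coset B (scale a z) = coset B (scale (c * a) z)" for a c
    by (simp add: quotient_space_def coset_scale[OF B] scale_simps)
  have smult': "c \<odot>\<^bsub>?Q'\<^esub> coset B' (scale a z') = coset B' (scale (c * a) z')" for a c
    by (simp add: quotient_space_def coset_scale[OF B'] scale_simps)
  have "h \<in> hom (add_monoid ?Q) (add_monoid ?Q')"
    by (rule homI) (auto simp: carrier h add add')
  moreover have "bij_betw h (carrier ?Q) (carrier ?Q')"
    unfolding bij_betw_def inj_on_def carrier using h eq by (auto simp: image_image)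
  ultimately have "h \<in> iso (add_monoid ?Q) (add_monoid ?Q')"
    by (simp add: iso_def)
  moreover have "\<forall>c. \<forall>x\<in>carrier ?Q. h (c \<odot>\<^bsub>?Q\<^esub> x) = c \<odot>\<^bsub>?Q'\<^esub> h x"
    by (auto simp: carrier h smult smult')
  ultimately show ?thesis
    unfolding linearly_isomorphic_def by blast
qed

section \<open>Multipath cohomology of alternating linear graphs\<close>

lemma sum_fun_apply: "(\<Sum>a\<in>A. F a) x = (\<Sum>a\<in>A. F a x)"
  by (induction A rule: infinite_finite_induct) auto

lemma cochains_subspace: "subspace (cochains G i)"
  unfolding subspace_def cochains_def scale_def by auto (metis add.right_neutral)+

lemma differential_add: "differential G r (f + g) = differential G r f + differential G r g"
  by (simp add: differential_def scale_simps sum.distrib)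

lemma differential_scale: "differential G r (scale c f) = scale c (differential G r f)"
  by (rule ext) (simp add: differential_def scale_def sum_fun_apply sum_distrib_left mult.assoc)

lemma differential_zero: "differential G r 0 = 0"
  by (simp add: differential_def scale_simps)

lemma coboundaries_subspace:
  "subspace (coboundaries G r i :: ('a pair_pre_digraph \<Rightarrow> 'k::field) set)"
  unfolding subspace_def
proof (intro conjI ballI allI)
  note C = subspaceD[OF cochains_subspace[of G "i - 1"]]
  show "0 \<in> coboundaries G r i"
    unfolding coboundaries_def using C(1) differential_zero by (metis image_eqI)
  show "x + y \<in> coboundaries G r i" if "x \<in> coboundaries G r i" "y \<in> coboundaries G r i"
    for x y :: "'a pair_pre_digraph \<Rightarrow> 'k"
  proof -
    from that obtain f g where "f \<in> cochains G (i - 1)" "g \<in> cochains G (i - 1)"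
      "x + y = differential G r (f + g)"
      unfolding coboundaries_def by (auto simp only: differential_add)
    then show ?thesis unfolding coboundaries_def using C(2) by blast
  qed
  show "scale c x \<in> coboundaries G r i" if "x \<in> coboundaries G r i"
    for c and x :: "'a pair_pre_digraph \<Rightarrow> 'k"
  proof -
    from that obtain f where "f \<in> cochains G (i - 1)" "scale c x = differential G r (scale c f)"
      unfolding coboundaries_def by (auto simp only: differential_scale)
    then show ?thesis unfolding coboundaries_def using C(3) by blast
  qed
qed

lemma epsilon_insert:
  assumes "finite (parcs H)" "a \<notin> parcs H"
  shows "epsilon r (add_edge H a) b = epsilon r H b + (if a \<noteq> b \<and> (a, b) \<in> r then 1 else 0)"
proof -
  have "{f \<in> parcs (add_edge H a). f \<noteq> b \<and> (f, b) \<in> r} =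
      (if a \<noteq> b \<and> (a, b) \<in> r then insert a {f \<in> parcs H. f \<noteq> b \<and> (f, b) \<in> r}
       else {f \<in> parcs H. f \<noteq> b \<and> (f, b) \<in> r})"
    by (auto simp: add_edge_def)
  then show ?thesis
    using assms by (simp add: epsilon_def)
qed

text \<open>This is the interface between graphs and sets: orientations enter only through
  \<open>multipath_iff\<close>. The parameter \<open>K\<close> fixes the field of
  coefficients.\<close>

locale multipaths_sparse =
  fixes n :: nat and G :: "'a pair_pre_digraph" and r :: "('a \<times> 'a) rel"
    and e :: "nat \<Rightarrow> 'a \<times> 'a" and K :: "'k::field itself"
  assumes bij: "bij_betw e {1..n} (parcs G)"
    and order: "linear_order_on (parcs G) r"
    and multipath_iff:
      "multipath G H \<longleftrightarrow> (\<exists>S. sparse n S \<and> H = \<lparr>pverts = pverts G, parcs = e ` S\<rparr>)"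
begin

section \<open>Translation from sets to multipaths, and the signs\<close>

definition emb :: "nat set \<Rightarrow> 'a pair_pre_digraph" where
  "emb S = \<lparr>pverts = pverts G, parcs = e ` S\<rparr>"

definition sign :: "nat set \<Rightarrow> nat \<Rightarrow> 'k" where
  "sign S k = (- 1) ^ epsilon r (emb S) (e k)"

lemma inj: "inj_on e {1..n}" and parcs_eq: "parcs G = e ` {1..n}"
  using bij by (auto simp: bij_betw_def)

lemma e_eq: "i \<in> {1..n} \<Longrightarrow> j \<in> {1..n} \<Longrightarrow> e i = e j \<longleftrightarrow> i = j"
  by (rule inj_on_eq_iff[OF inj])

lemma e_in_image: "k \<in> {1..n} \<Longrightarrow> S \<subseteq> {1..n} \<Longrightarrow> e k \<in> e ` S \<longleftrightarrow> k \<in> S"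
  by (rule inj_on_image_mem_iff[OF inj])

lemma add_edge_emb: "add_edge (emb S) (e k) = emb (insert k S)"
  by (simp add: add_edge_def emb_def)

lemma emb_eq: "S \<subseteq> {1..n} \<Longrightarrow> S' \<subseteq> {1..n} \<Longrightarrow> emb S = emb S' \<longleftrightarrow> S = S'"
  using inj_on_image_eq_iff[OF inj] by (simp add: emb_def)

lemma multipath_emb: "S \<subseteq> {1..n} \<Longrightarrow> multipath G (emb S) \<longleftrightarrow> sparse n S"
  using emb_eq unfolding multipath_iff emb_def[symmetric] sparse_def by metis

lemma multipathE:
  assumes "multipath G H" obtains S where "sparse n S" "H = emb S"
  using assms unfolding multipath_iff emb_def by blast

text \<open>Of two distinct edges exactly one precedes the other. Hence, of the two orders of adding
  them, exactly one contributes an additional factor \<open>- 1\<close>.\<close>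

lemma sign_anticommuting: "anticommuting_signs n sign"
proof
  show "sign S a * sign S a = 1" for S a
    by (simp add: sign_def flip: power_add mult_2)
  fix S a b assume S: "S \<subseteq> {1..n}" and ab: "a \<in> {1..n} - S" "b \<in> {1..n} - S" "a \<noteq> b"
  have fin: "finite (parcs (emb S))"
    using S finite_subset by (auto simp: emb_def)
  have notin: "e a \<notin> parcs (emb S)" "e b \<notin> parcs (emb S)"
    using S ab e_in_image[of a S] e_in_image[of b S] by (auto simp: emb_def)
  have "e a \<in> parcs G" "e b \<in> parcs G" and neq: "e a \<noteq> e b"
    using ab e_eq[of a b] by (auto simp: parcs_eq)
  then have one: "(e a, e b) \<in> r \<longleftrightarrow> (e b, e a) \<notin> r"
    using order unfolding linear_order_on_def partial_order_on_def total_on_def antisym_def by blast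
  show "sign S a * sign (insert a S) b = - (sign S b * sign (insert b S) a)"
    unfolding sign_def add_edge_emb[symmetric]
    using one neq by (simp add: epsilon_insert[OF fin notin(1)] epsilon_insert[OF fin notin(2)])
qed

end

sublocale multipaths_sparse \<subseteq> anticommuting_signs n sign
  by (rule sign_anticommuting)

context multipaths_sparse
begin

section \<open>Identification of the two complexes\<close>

definition restr :: "('a pair_pre_digraph \<Rightarrow> 'k) \<Rightarrow> nat set \<Rightarrow> 'k" where
  "restr f S = (if sparse n S then f (emb S) else 0)"

text \<open>On cochains this is inverse to \<open>restr\<close>; the set of indices is recovered
  from the arcs of \<open>H\<close>.\<close>

definition extend :: "(nat set \<Rightarrow> 'k) \<Rightarrow> 'a pair_pre_digraph \<Rightarrow> 'k" where
  "extend F H = (if multipath G H then F {k \<in> {1..n}. e k \<in> parcs H} else 0)"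

lemma extend_emb: "sparse n S \<Longrightarrow> extend F (emb S) = F S"
proof -
  assume S: "sparse n S"
  then have sub: "S \<subseteq> {1..n}" by (simp add: sparse_def)
  then have "{k \<in> {1..n}. e k \<in> parcs (emb S)} = S"
    using e_in_image[OF _ sub] by (auto simp: emb_def)
  then show ?thesis using S sub by (simp add: extend_def multipath_emb)
qed

lemma eq_extendI:
  assumes "\<And>H. f H \<noteq> 0 \<Longrightarrow> multipath G H" "\<And>S. sparse n S \<Longrightarrow> f (emb S) = F S"
  shows "f = extend F"
proof
  fix H
  show "f H = extend F H"
  proof (cases "multipath G H")
    case True
    then obtain S where "sparse n S" "H = emb S" by (rule multipathE)
    then show ?thesis using assms(2) by (simp add: extend_emb)
  qed (use assms(1) in \<open>auto simp: extend_def\<close>)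
qed

lemma card_emb: "sparse n S \<Longrightarrow> card (parcs (emb S)) = card S"
  unfolding emb_def sparse_def by (auto intro!: card_image inj_on_subset[OF inj])

lemma cochain_restr:
  assumes "f \<in> cochains G i"
  shows "cochain i (restr f)" "extend (restr f) = f"
proof -
  show "cochain i (restr f)"
    using assms card_emb by (auto simp: cochains_def cochain_def restr_def split: if_splits)
  show "extend (restr f) = f"
    using assms by (intro eq_extendI[symmetric]) (auto simp: cochains_def restr_def)
qed

lemma cochain_extend:
  assumes "cochain i F"
  shows "extend F \<in> cochains G i" "restr (extend F) = F"
proof -
  have "multipath G H \<and> int (card (parcs H)) = i" if "extend F H \<noteq> 0" for H
  proof -
    have H: "multipath G H" using that by (auto simp: extend_def split: if_splits)
    then obtain S where "sparse n S" "H = emb S" by (rule multipathE)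
    then show ?thesis
      using H that assms by (auto simp: extend_emb card_emb cochain_def)
  qed
  then show "extend F \<in> cochains G i" by (auto simp: cochains_def)
  show "restr (extend F) = F"
    using assms by (auto simp: fun_eq_iff restr_def extend_emb cochain_def)
qed

text \<open>This turns the sum over insertions into \<open>S\<close> into a sum over removals from
  \<open>T\<close>, the form used by \<open>d\<close>. At most one summand on the right is
  nonzero.\<close>

lemma d_basis_emb:
  assumes S: "sparse n S" and T: "sparse n T"
  shows "d_basis G r (emb S) (emb T) = (\<Sum>k\<in>T. if S = T - {k} then sign S k else 0)"
proof -
  have sub: "S \<subseteq> {1..n}" "T \<subseteq> {1..n}" using S T by (auto simp: sparse_def)
  let ?A = "{k \<in> {1..n} - S. sparse n (insert k S)}"
  have "{a. a \<in> parcs G - parcs (emb S) \<and> multipath G (add_edge (emb S) a)} = e ` ?A"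
  proof -
    have "parcs G - parcs (emb S) = e ` ({1..n} - S)"
      using inj_on_image_set_diff[OF inj Diff_subset sub(1)] by (simp add: emb_def parcs_eq)
    then show ?thesis
      using sub by (auto simp: add_edge_emb multipath_emb)
  qed
  moreover have "inj_on e ?A"
    by (rule inj_on_subset[OF inj]) auto
  ultimately have "(d_basis G r (emb S) :: _ \<Rightarrow> 'k) (emb T) =
      (\<Sum>k\<in>?A. sign S k * (if emb T = emb (insert k S) then 1 else 0))"
    by (simp add: d_basis_def sum_fun_apply sum.reindex scale_def basis_vec_def add_edge_emb sign_def
        cong: if_cong)
  also have "\<dots> = (\<Sum>k\<in>?A. if T = insert k S then sign S k else 0)"
    using sub by (intro sum.cong refl) (auto simp: emb_eq)
  also have "\<dots> = (\<Sum>k\<in>T. if S = T - {k} then sign S k else 0)"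
  proof -
    have "{k \<in> ?A. T = insert k S} = {k \<in> T. S = T - {k}}"
    proof (intro equalityI subsetI)
      fix k assume "k \<in> {k \<in> T. S = T - {k}}"
      then have k: "k \<in> T" "k \<notin> S" "insert k S = T" by auto
      then show "k \<in> {k \<in> ?A. T = insert k S}" using T sub(2) by blast
    qed auto
    then show ?thesis
      using sparse_finite[OF T] by (simp flip: sum.inter_filter)
  qed
  finally show ?thesis .
qed

text \<open>No cochain hypothesis is needed, since both sides evaluate \<open>f\<close> at
  multipaths only. After exchanging the sums, each inner sum reduces to its term at
  \<open>T - {k}\<close>, which is sparse because \<open>T\<close> is.\<close>

lemma differential_eq: "differential G r f = extend (d (restr f))"
proof (rule eq_extendI)
  fix H assume "differential G r f H \<noteq> 0"
  then have "(\<Sum>H' | multipath G H'. f H' * d_basis G r H' H) \<noteq> 0"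
    by (simp add: differential_def sum_fun_apply scale_def)
  then obtain H' where H': "(d_basis G r H' :: _ \<Rightarrow> 'k) H \<noteq> 0"
    by (metis (mono_tags, lifting) mult_zero_right sum.neutral)
  show "multipath G H"
  proof (rule ccontr)
    assume "\<not> multipath G H"
    then have "(d_basis G r H' :: _ \<Rightarrow> 'k) H = 0"
      unfolding d_basis_def sum_fun_apply scale_def basis_vec_def by (intro sum.neutral) auto
    then show False using H' by blast
  qed
next
  fix T assume T: "sparse n T"
  have fin: "finite {S. sparse n S}"
    by (rule finite_subset[of _ "Pow {1..n}"]) (auto simp: sparse_def)
  have M: "{H. multipath G H} = emb ` {S. sparse n S}"
    using multipath_emb by (auto elim!: multipathE simp: sparse_def)
  have "inj_on emb {S. sparse n S}"
    using emb_eq by (auto simp: inj_on_def sparse_def)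
  then have "differential G r f (emb T) =
      (\<Sum>S | sparse n S. f (emb S) * d_basis G r (emb S) (emb T))"
    by (simp add: differential_def M sum_fun_apply sum.reindex scale_def)
  also have "\<dots> = (\<Sum>S | sparse n S. \<Sum>k\<in>T. if S = T - {k} then sign S k * f (emb S) else 0)"
    by (intro sum.cong refl) (use T in \<open>auto simp: d_basis_emb sum_distrib_left intro!: sum.cong\<close>)
  also have "\<dots> = (\<Sum>k\<in>T. \<Sum>S | sparse n S. if S = T - {k} then sign S k * f (emb S) else 0)"
    by (rule sum.swap)
  also have "\<dots> = (\<Sum>k\<in>T. sign (T - {k}) k * restr f (T - {k}))"
    using sparse_subset[OF T] by (intro sum.cong refl) (auto simp: fin restr_def)
  finally show "differential G r f (emb T) = d (restr f) T"
    using T by (simp add: d_def)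
qed

lemma restr_differential: "restr (differential G r f) = d (restr f)"
  by (auto simp: fun_eq_iff differential_eq restr_def extend_emb d_def)

lemma extend_zero: "extend (\<lambda>S. 0) = 0"
  by (auto simp: fun_eq_iff extend_def)

lemma cocycle_restr:
  assumes "f \<in> cocycles G r i"
  shows "cochain i (restr f)" "d (restr f) = (\<lambda>S. 0)" "extend (restr f) = f"
proof -
  have f: "f \<in> cochains G i" "differential G r f = 0" using assms by (auto simp: cocycles_def)
  show "cochain i (restr f)" "extend (restr f) = f" using cochain_restr[OF f(1)] by auto
  show "d (restr f) = (\<lambda>S. 0)"
    using restr_differential[of f] by (simp add: f(2) fun_eq_iff restr_def zero_fun_def)
qed

lemma coboundaries_eq: "coboundaries G r i = {extend (d y) | y. cochain (i - 1) y}"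
  unfolding coboundaries_def differential_eq using cochain_restr cochain_extend
  by (auto simp: image_iff) metis

lemma coboundaries_cocycles: "coboundaries G r i \<subseteq> (cocycles G r i :: (_ \<Rightarrow> 'k) set)"
proof
  fix f :: "_ \<Rightarrow> 'k" assume "f \<in> coboundaries G r i"
  then obtain y where y: "cochain (i - 1) y" "f = extend (d y)"
    unfolding coboundaries_eq by blast
  have c: "cochain i (d y)" using cochain_d[OF y(1)] by simp
  have "d (d y) = (\<lambda>S. 0)" by (simp add: d_d fun_eq_iff)
  then show "f \<in> cocycles G r i"
    using cochain_extend[OF c] by (simp add: cocycles_def y differential_eq extend_zero)
qed

lemma cohomology_trivial:
  assumes "n mod 3 = 1"
  shows "carrier (multipath_cohomology K G r i) = {\<zero>\<^bsub>multipath_cohomology K G r i\<^esub>}"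
proof -
  have "cocycles G r i \<subseteq> (coboundaries G r i :: (_ \<Rightarrow> 'k) set)"
  proof
    fix f :: "_ \<Rightarrow> 'k" assume "f \<in> cocycles G r i"
    note f = cocycle_restr[OF this]
    obtain y where "cochain (i - 1) y" "d y = restr f"
      using acyclic[OF assms f(1,2)] by blast
    then show "f \<in> coboundaries G r i"
      unfolding coboundaries_eq using f(3) by force
  qed
  \<comment> \<open>With \<open>0\<close> as generator, the description of the carrier by multiples
    of one class leaves a single coset.\<close>
  then have "cocycles G r i = span_mod (0 :: _ \<Rightarrow> 'k) (coboundaries G r i)"
    using coboundaries_cocycles by (auto simp: span_mod_def scale_simps)
  then show ?thesis
    using carrier_quotient_span_mod[OF coboundaries_subspace[of G r i], of "0 :: _ \<Rightarrow> 'k"]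
    by (simp add: multipath_cohomology_def scale_simps coset_zero) (simp add: quotient_space_def)
qed

text \<open>All degrees are treated alike: \<open>z\<close> represents the surviving class in its
  degree and is zero elsewhere, where it is trivially a coboundary.\<close>

lemma cocycles_span_mod:
  assumes n: "n mod 3 \<noteq> 1"
  obtains z where "cocycles G r i = span_mod z (coboundaries G r i)"
    "(z :: _ \<Rightarrow> 'k) \<in> coboundaries G r i \<longleftrightarrow> i \<noteq> int ((n + 1) div 3)"
proof
  let ?m = "int ((n + 1) div 3)"
  define z where "z = (if i = ?m then extend generator else 0)"
  have "differential G r (extend generator) = 0"
    using cochain_extend[OF cochain_generator] d_generator[OF n]
    by (simp add: differential_eq extend_zero)
  then have "differential G r z = 0"
    by (simp add: z_def differential_zero)
  then have z: "z \<in> cocycles G r i"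
    using cochain_extend[OF cochain_generator] subspaceD(1)[OF cochains_subspace]
    by (auto simp: cocycles_def z_def)
  show "cocycles G r i = span_mod z (coboundaries G r i)"
  proof
    show "span_mod z (coboundaries G r i) \<subseteq> cocycles G r i"
    proof
      fix f assume "f \<in> span_mod z (coboundaries G r i)"
      then obtain c y where f: "f = scale c z + y" "y \<in> cocycles G r i"
        using coboundaries_cocycles unfolding span_mod_def by blast
      then show "f \<in> cocycles G r i"
        using z subspaceD(2,3)[OF cochains_subspace[of G i]]
        by (auto simp: cocycles_def differential_add differential_scale scale_simps)
    qed
    show "cocycles G r i \<subseteq> span_mod z (coboundaries G r i)"
    proof
      fix f :: "_ \<Rightarrow> 'k" assume "f \<in> cocycles G r i"
      note f = cocycle_restr[OF this]
      from cocycle_eq[OF n f(1,2)] obtain c y where y: "cochain (i - 1) y"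
        "restr f = (\<lambda>S. c * generator S + d y S)" "i \<noteq> ?m \<longrightarrow> c = 0" by blast
      have "f = extend (\<lambda>S. c * generator S + d y S)" using f(3) y(2) by simp
      also have "\<dots> = scale c z + extend (d y)"
        using y(3) by (auto simp: fun_eq_iff extend_def scale_def z_def)
      finally show "f \<in> span_mod z (coboundaries G r i)"
        using y(1) unfolding span_mod_def coboundaries_eq by blast
    qed
  qed
  have "extend generator \<notin> coboundaries G r i" if "i = ?m"
  proof
    assume "extend generator \<in> coboundaries G r i"
    then obtain y where y: "cochain (i - 1) y" "extend generator = extend (d y)"
      unfolding coboundaries_eq by blast
    have "cochain ?m (d y)" using cochain_d[OF y(1)] that by simp
    then have "generator = d y"
      using y(2) cochain_extend(2) cochain_generator by metis
    then show False using generator_not_coboundary[OF n, of y] y(1) that by simp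
  qed
  then show "z \<in> coboundaries G r i \<longleftrightarrow> i \<noteq> ?m"
    using subspaceD(1)[OF coboundaries_subspace] by (auto simp: z_def)
qed

end

lemma multipaths_sparse_if_is_A:
  assumes "is_A n G" "linear_order_on (parcs G) r"
  obtains e where "multipaths_sparse n G r e"
proof -
  from alternating_linear_graph[OF assms(1)] obtain e where
    "bij_betw e {1..n} (parcs G)"
    "\<And>H. multipath G H \<longleftrightarrow> (\<exists>S. sparse n S \<and> H = \<lparr>pverts = pverts G, parcs = e ` S\<rparr>)"
    by blast
  then have "multipaths_sparse n G r e"
    using assms(2) by unfold_locales
  then show thesis by (rule that)
qed

text \<open>In each degree the cohomology is zero or a line, so it only matters whether that degree
  is the one of the surviving class.\<close>

lemma multipath_cohomology_iso:
  fixes K :: "'k::field itself"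
    and G :: "'a pair_pre_digraph" and r :: "('a \<times> 'a) rel"
    and G' :: "'b pair_pre_digraph" and r' :: "('b \<times> 'b) rel"
  assumes "is_A n G" "linear_order_on (parcs G) r" "n mod 3 \<noteq> 1"
    and "is_A n' G'" "linear_order_on (parcs G') r'" "n' mod 3 \<noteq> 1"
    and degree: "i = int ((n + 1) div 3) \<longleftrightarrow> i' = int ((n' + 1) div 3)"
  shows "multipath_cohomology K G r i \<cong>\<^sub>l\<^sub>i\<^sub>n multipath_cohomology K G' r' i'"
proof -
  obtain e e' where "multipaths_sparse n G r e" "multipaths_sparse n' G' r' e'"
    using assms multipaths_sparse_if_is_A by metis
  then interpret A: multipaths_sparse n G r e K + A': multipaths_sparse n' G' r' e' K .
  obtain z where z: "cocycles G r i = span_mod z (coboundaries G r i)"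
    "(z :: _ \<Rightarrow> 'k) \<in> coboundaries G r i \<longleftrightarrow> i \<noteq> int ((n + 1) div 3)"
    using A.cocycles_span_mod[OF assms(3)] by blast
  obtain z' where z': "cocycles G' r' i' = span_mod z' (coboundaries G' r' i')"
    "(z' :: _ \<Rightarrow> 'k) \<in> coboundaries G' r' i' \<longleftrightarrow> i' \<noteq> int ((n' + 1) div 3)"
    using A'.cocycles_span_mod[OF assms(6)] by blast
  show ?thesis
    unfolding multipath_cohomology_def z(1) z'(1)
    using degree z(2) z'(2) by (intro quotient_span_mod_iso coboundaries_subspace) blast
qed

theorem theorem5p6:
  fixes n :: nat
    and G :: "'a pair_pre_digraph" and r :: "('a \<times> 'a) rel"
    and G1 :: "'b pair_pre_digraph" and r1 :: "('b \<times> 'b) rel"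
    and G2 :: "'c pair_pre_digraph" and r2 :: "('c \<times> 'c) rel"
  assumes "n \<ge> 1"
    and "is_A n G" and "linear_order_on (parcs G) r"
  shows
    "(n mod 3 = 0 \<longrightarrow> is_A (n - 1) G1 \<longrightarrow> linear_order_on (parcs G1) r1 \<longrightarrow>
        (\<forall>i. multipath_cohomology TYPE('k::field) G r i
               \<cong>\<^sub>l\<^sub>i\<^sub>n multipath_cohomology TYPE('k) G1 r1 i)) \<and>
     (n mod 3 = 1 \<longrightarrow>
        (\<forall>i. carrier (multipath_cohomology TYPE('k) G r i)
               = {\<zero>\<^bsub>multipath_cohomology TYPE('k) G r i\<^esub>})) \<and>
     (n mod 3 = 2 \<longrightarrow> is_A (n - 2) G2 \<longrightarrow> linear_order_on (parcs G2) r2 \<longrightarrow>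
        (\<forall>i. multipath_cohomology TYPE('k) G r i
               \<cong>\<^sub>l\<^sub>i\<^sub>n multipath_cohomology TYPE('k) G2 r2 (i - 1)))"
proof (intro conjI impI allI)
  fix i
  assume mod: "n mod 3 = 0" and G1: "is_A (n - 1) G1" "linear_order_on (parcs G1) r1"
  \<comment> \<open>A positive multiple of 3 is at least 3, so the truncated subtraction is
    exact.\<close>
  have "n = 3 * (n div 3 - 1) + 3"
    using mod \<open>n \<ge> 1\<close> div_mult_mod_eq[of n 3] by linarith
  then obtain k where n: "n = 3 * k + 3" by blast
  \<comment> \<open>Both surviving classes have degree \<open>k + 1\<close>, hence no shift.\<close>
  have "n mod 3 \<noteq> 1" "(n - 1) mod 3 \<noteq> 1" "(n + 1) div 3 = (n - 1 + 1) div 3"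
    by (simp_all add: n div_Suc mod_Suc)
  then show "multipath_cohomology TYPE('k) G r i \<cong>\<^sub>l\<^sub>i\<^sub>n multipath_cohomology TYPE('k) G1 r1 i"
    by (intro multipath_cohomology_iso[OF assms(2,3) _ G1]) auto
next
  fix i
  obtain e where "multipaths_sparse n G r e"
    using assms(2,3) by (rule multipaths_sparse_if_is_A)
  then interpret multipaths_sparse n G r e "TYPE('k)" .
  assume "n mod 3 = 1"
  then show "carrier (multipath_cohomology TYPE('k) G r i) = {\<zero>\<^bsub>multipath_cohomology TYPE('k) G r i\<^esub>}"
    by (rule cohomology_trivial)
next
  fix i
  assume mod: "n mod 3 = 2" and G2: "is_A (n - 2) G2" "linear_order_on (parcs G2) r2"
  have "n = 3 * (n div 3) + 2"
    using mod div_mult_mod_eq[of n 3] by linarith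
  then obtain k where n: "n = 3 * k + 2" by blast
  \<comment> \<open>The surviving classes have degrees \<open>k + 1\<close> and \<open>k\<close>,
    which accounts for the shift by one.\<close>
  have "n mod 3 \<noteq> 1" "(n - 2) mod 3 \<noteq> 1" "(n + 1) div 3 = (n - 2 + 1) div 3 + 1"
    by (simp_all add: n div_Suc mod_Suc)
  then show "multipath_cohomology TYPE('k) G r i \<cong>\<^sub>l\<^sub>i\<^sub>n multipath_cohomology TYPE('k) G2 r2 (i - 1)"
    by (intro multipath_cohomology_iso[OF assms(2,3) _ G2]) auto
qed

end
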